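(* For $n\ge1$ let $L_n=\langle\gamma_n(W),F\rangle\le W$. Then $L_n$ is a layered group of height $n-1$, and $\mathrm{Aut}^m(L_n)=L_{n-m}$ for all $m\in\{0,\dots,n-1\}$.
   Context: $W$ is the isometry group of the binary rooted tree $X^*$, $X=\{0,1\}$; $\gamma_n(W)$ is the $n$-th term of the lower central series of $W$ ($\gamma_1(W)=W$). For $v\in X^*$ and $g\in W$, $v*g$ acts as $g$ on the subtree below $v$ and fixes other vertices; $F=\langle v*\sigma:v\in X^*\rangle$ is the finitary group, where $\sigma$ swaps the two subtrees at the root rigidly. $L\le W$ is layered if it is transitive on each level $X^k$ and $x*L\le L$ for $x\in X$. The automorphism tower $\mathrm{Aut}^m$ is realized inside $W$ via conjugation (as the normalizer tower in $W$); the height is the least $\alpha$ with $\mathrm{Aut}^\alpha=\mathrm{Aut}^{\alpha+1}$. *)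

theory Defs
  imports "HOL-Algebra.Group_Action" "HOL-Algebra.Generated_Groups" "HOL-Library.Sublist"
begin

text \<open>Vertices of the binary rooted tree X^* (X = {0,1} encoded as bool) are lists.
  Tree automorphisms (= isometries of X^*): bijections preserving length and prefixes.\<close>

definition tree_aut :: "(bool list \<Rightarrow> bool list) \<Rightarrow> bool" where
  "tree_aut f \<longleftrightarrow> bij f \<and> (\<forall>u. length (f u) = length u) \<and>
     (\<forall>u v. prefix u v \<longrightarrow> prefix (f u) (f v))"

definition W :: "(bool list \<Rightarrow> bool list) monoid" where
  "W = \<lparr>carrier = {f. tree_aut f}, mult = (\<circ>), one = id\<rparr>"

fun gamma :: "nat \<Rightarrow> (bool list \<Rightarrow> bool list) set" where
  "gamma 0 = carrier W"
| "gamma (Suc 0) = carrier W"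
| "gamma (Suc (Suc n)) = generate W
     (\<Union>x \<in> gamma (Suc n). \<Union>y \<in> carrier W.
        {x \<otimes>\<^bsub>W\<^esub> y \<otimes>\<^bsub>W\<^esub> inv\<^bsub>W\<^esub> x \<otimes>\<^bsub>W\<^esub> inv\<^bsub>W\<^esub> y})"

definition below :: "bool list \<Rightarrow> (bool list \<Rightarrow> bool list) \<Rightarrow> (bool list \<Rightarrow> bool list)" where
  "below v g = (\<lambda>u. if prefix v u then v @ g (drop (length v) u) else u)"

definition sigma :: "bool list \<Rightarrow> bool list" where
  "sigma u = (case u of [] \<Rightarrow> [] | b # w \<Rightarrow> (\<not> b) # w)"

definition finitary :: "(bool list \<Rightarrow> bool list) set" where
  "finitary = generate W {below v sigma | v. True}"

definition layered :: "(bool list \<Rightarrow> bool list) set \<Rightarrow> bool" where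
  "layered L \<longleftrightarrow> subgroup L W \<and>
     (\<forall>u v. length u = length v \<longrightarrow> (\<exists>g\<in>L. g u = v)) \<and>
     (\<forall>x::bool. \<forall>g\<in>L. below [x] g \<in> L)"

text \<open>Automorphism tower realized in W as the normalizer tower.\<close>
fun aut_tower :: "(bool list \<Rightarrow> bool list) set \<Rightarrow> nat \<Rightarrow> (bool list \<Rightarrow> bool list) set" where
  "aut_tower L 0 = L"
| "aut_tower L (Suc m) = normalizer W (aut_tower L m)"

definition tower_height :: "(bool list \<Rightarrow> bool list) set \<Rightarrow> nat \<Rightarrow> bool" where
  "tower_height L h \<longleftrightarrow> aut_tower L h = aut_tower L (Suc h) \<and>
     (\<forall>k<h. aut_tower L k \<noteq> aut_tower L (Suc k))"

definition Ln :: "nat \<Rightarrow> (bool list \<Rightarrow> bool list) set" where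
  "Ln n = generate W (gamma n \<union> finitary)"

end

theory Submission
  imports Defs "HOL-Library.Z2"
begin

text \<open>Record an automorphism \<open>g\<close> by its portrait, a function from vertices to the field with two
  elements. On the level \<open>k\<close>, the functions spanned by the binomial coefficients of \<open>v\<close> over
  \<open>j < d\<close> (vertices being read as binary numbers) form a filtration on which automorphisms act
  unipotently. Let \<open>Orth d\<close> consist of the automorphisms whose portrait is orthogonal to this
  span on every level. Elements of \<open>Orth d\<close> fix the next span of the filtration, whence
  \<open>[Orth d, W] \<subseteq> Orth (d + 1)\<close>. Conversely, for \<open>g \<in> Orth (d + 1)\<close> and the odometer \<open>t\<close>,
  \<open>g t\<close> is a cycle on every level, so it equals \<open>x t x\<inverse>\<close> for some \<open>x\<close>, and Pascal's rule
  gives \<open>x \<in> Orth d\<close>; hence \<open>gamma (d + 1) = Orth d\<close>. Multiplying by the finitary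
  group relaxes the conditions to all but finitely many levels, and commutators with truncated
  odometers show, again by Pascal's rule, that the normalizer lowers \<open>d\<close> by exactly one.\<close>

text \<open>These rules rewrite the field operations to bitwise ones, for which the ring lemmas no
  longer apply.\<close>

declare add_bit_eq_xor [simp del] mult_bit_eq_and [simp del]

section \<open>Tree automorphisms and their portraits\<close>

lemma bit_add_self [simp]: "(x :: bit) + x = 0"
  by (cases x) simp_all

lemma finite_level [simp]: "finite {v :: bool list. length v = k}"
  using finite_lists_length_eq[of "UNIV :: bool set" k] by simp

lemma tree_aut_length: "tree_aut g \<Longrightarrow> length (g v) = length v"
  by (simp add: tree_aut_def)

lemma tree_aut_inj: "tree_aut g \<Longrightarrow> inj g"
  by (simp add: tree_aut_def bij_def)

lemma tree_aut_Nil: "tree_aut g \<Longrightarrow> g [] = []"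
  by (metis tree_aut_length length_0_conv)

text \<open>Surjectivity is automatic: an injective map preserving length permutes every finite
  level.\<close>

lemma tree_autI:
  assumes len: "\<And>u. length (f u) = length u"
    and pre: "\<And>u v. prefix u v \<Longrightarrow> prefix (f u) (f v)" and inj: "inj f"
  shows "tree_aut f"
proof -
  have "v \<in> range f" for v
  proof -
    let ?S = "{w :: bool list. length w = length v}"
    have "f ` ?S = ?S"
      by (rule endo_inj_surj) (use len inj in \<open>auto intro: inj_on_subset\<close>)
    then show ?thesis by blast
  qed
  then show ?thesis
    using len pre inj by (auto simp: tree_aut_def bij_def)
qed

lemma tree_aut_id [simp]: "tree_aut id"
  by (simp add: tree_aut_def)

lemma tree_aut_comp [simp]: "tree_aut f \<Longrightarrow> tree_aut g \<Longrightarrow> tree_aut (f \<circ> g)"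
  by (auto simp: tree_aut_def bij_comp)

lemma tree_aut_prefix: "tree_aut g \<Longrightarrow> prefix u v \<Longrightarrow> prefix (g u) (g v)"
  by (simp add: tree_aut_def)

lemma tree_aut_take: "tree_aut g \<Longrightarrow> g (take n v) = take n (g v)"
proof -
  assume g: "tree_aut g"
  obtain z where "g v = g (take n v) @ z"
    using tree_aut_prefix[OF g take_is_prefix[of n v]] by (auto simp: prefix_def)
  then show ?thesis
    using tree_aut_length[OF g, of v] tree_aut_length[OF g, of "take n v"]
    by (cases "n \<le> length v") auto
qed

lemma tree_aut_inv:
  assumes g: "tree_aut g"
  obtains h where "tree_aut h" "\<And>v. h (g v) = v" "\<And>v. g (h v) = v"
proof
  let ?h = "inv_into UNIV g"
  have b: "bij g" using g by (simp add: tree_aut_def)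
  show hg: "?h (g v) = v" for v
    using b by (simp add: bij_def)
  show gh: "g (?h v) = v" for v
    using b by (simp add: bij_def surj_f_inv_f)
  have len: "length (?h v) = length v" for v
    using tree_aut_length[OF g, of "?h v"] gh by simp
  show "tree_aut ?h"
  proof (rule tree_autI[OF len])
    fix u v :: "bool list" assume "prefix u v"
    then have "g (take (length u) (?h v)) = u"
      by (auto simp: tree_aut_take[OF g] gh prefix_def)
    then have "?h u = take (length u) (?h v)" using hg by metis
    then show "prefix (?h u) (?h v)" by (simp add: take_is_prefix)
  next
    show "inj ?h" using gh by (metis injI)
  qed
qed

text \<open>For an automorphism the value is 1 exactly when \<open>g\<close> exchanges the last
  letters of the two children of \<open>v\<close>; the image of \<open>v @ [False]\<close> then ends
  in \<open>True\<close>.\<close>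

definition portrait :: "(bool list \<Rightarrow> bool list) \<Rightarrow> bool list \<Rightarrow> bit" where
  "portrait g v = of_bool (last (g (v @ [False])))"

lemma tree_aut_snoc:
  assumes g: "tree_aut g"
  shows "g (v @ [b]) = g v @ [b = (portrait g v = 0)]"
proof -
  have "\<exists>c. g (v @ [b]) = g v @ [c]" for b
  proof -
    have "take (length v) (g (v @ [b])) = g v"
      using tree_aut_take[OF g, of "length v" "v @ [b]"] by simp
    moreover have "length (g (v @ [b])) = Suc (length v)" by (simp add: tree_aut_length[OF g])
    ultimately show ?thesis
      by (cases "g (v @ [b])" rule: rev_cases) auto
  qed
  then obtain c where c: "\<And>b. g (v @ [b]) = g v @ [c b]" by metis
  have "c True \<noteq> c False"
  proof
    assume "c True = c False"
    then have "g (v @ [True]) = g (v @ [False])" by (simp only: c)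
    then show False using injD[OF tree_aut_inj[OF g]] by fastforce
  qed
  then show ?thesis by (cases b) (auto simp: portrait_def c)
qed

text \<open>The cocycle rule behind all later level sums: two successive flips of a letter
  cancel.\<close>

lemma portrait_comp:
  assumes "tree_aut g" "tree_aut h"
  shows "portrait (g \<circ> h) v = portrait h v + portrait g (h v)"
proof -
  have "(g \<circ> h) (v @ [False]) = g (h v) @ [(False = (portrait h v = 0)) = (portrait g (h v) = 0)]"
    using assms by (simp add: tree_aut_snoc)
  then show ?thesis
    by (cases "portrait h v"; cases "portrait g (h v)") (simp_all add: portrait_def)
qed

lemma portrait_id [simp]: "portrait id v = 0" "portrait (\<lambda>v. v) v = 0"
  by (simp_all add: portrait_def)

lemma tree_aut_fixes_level:
  assumes g: "tree_aut g" and "\<And>u. length u < length v \<Longrightarrow> portrait g u = 0"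
  shows "g v = v"
  using assms(2) by (induction v rule: rev_induct) (simp_all add: tree_aut_Nil[OF g] tree_aut_snoc[OF g])

lemma sum_level_tree_aut:
  assumes "tree_aut g"
  shows "(\<Sum>v | length v = k. f (g v)) = (\<Sum>v | length v = k. f v)"
proof (rule sum.reindex_bij_betw)
  obtain h where h: "tree_aut h" "\<And>v. h (g v) = v" "\<And>v. g (h v) = v"
    by (rule tree_aut_inv[OF assms], rule that)
  show "bij_betw g {v. length v = k} {v. length v = k}"
    by (rule bij_betw_byWitness[where f' = h])
      (auto simp: h tree_aut_length[OF assms] tree_aut_length[OF h(1)])
qed

definition section_at :: "(bool list \<Rightarrow> bool list) \<Rightarrow> bool \<Rightarrow> bool list \<Rightarrow> bool list" where
  "section_at g b w = tl (g (b # w))"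

lemma tree_aut_Cons:
  assumes g: "tree_aut g"
  shows "g (b # w) = (b = (portrait g [] = 0)) # section_at g b w"
proof -
  have "take 1 (g (b # w)) = [b = (portrait g [] = 0)]"
    using tree_aut_take[OF g, of 1 "b # w"] tree_aut_snoc[OF g, of "[]" b] by (simp add: tree_aut_Nil[OF g])
  then show ?thesis
    by (cases "g (b # w)") (auto simp: section_at_def)
qed

lemma tree_aut_section:
  assumes g: "tree_aut g"
  shows "tree_aut (section_at g b)"
proof (rule tree_autI)
  show "length (section_at g b u) = length u" for u
    by (simp add: section_at_def tree_aut_length[OF g])
  show "prefix (section_at g b u) (section_at g b v)" if "prefix u v" for u v
    using tree_aut_prefix[OF g, of "b # u" "b # v"] that by (simp add: tree_aut_Cons[OF g])
  show "inj (section_at g b)"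
  proof (rule injI)
    fix u v assume "section_at g b u = section_at g b v"
    then have "g (b # u) = g (b # v)" by (simp add: tree_aut_Cons[OF g])
    then show "u = v" using tree_aut_inj[OF g] by (auto dest: injD)
  qed
qed

section \<open>The groups\<close>

lemma W_simps [simp]:
  "carrier W = {f. tree_aut f}" "f \<otimes>\<^bsub>W\<^esub> g = f \<circ> g" "one W = id"
  by (simp_all add: W_def)

lemma group_W: "group W"
proof (rule groupI)
  fix g assume "g \<in> carrier W"
  then have g: "tree_aut g" by simp
  obtain h where h: "tree_aut h" "\<And>v. h (g v) = v" "\<And>v. g (h v) = v"
    by (rule tree_aut_inv[OF g], rule that)
  then have "h \<circ> g = id" by (simp add: fun_eq_iff)
  with h(1) show "\<exists>h\<in>carrier W. h \<otimes>\<^bsub>W\<^esub> g = \<one>\<^bsub>W\<^esub>" by auto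
qed (simp_all add: comp_assoc)

interpretation W: group W
  by (rule group_W)

lemma tree_aut_inv_W [simp]: "tree_aut g \<Longrightarrow> tree_aut (inv\<^bsub>W\<^esub> g)"
  using W.inv_closed[of g] by simp

lemma inv_W_left: "tree_aut g \<Longrightarrow> inv\<^bsub>W\<^esub> g \<circ> g = id"
  using W.l_inv[of g] by simp

lemma inv_W_right: "tree_aut g \<Longrightarrow> g \<circ> inv\<^bsub>W\<^esub> g = id"
  using W.r_inv[of g] by simp

lemma inv_W_left_apply: "tree_aut g \<Longrightarrow> (inv\<^bsub>W\<^esub> g) (g v) = v"
  using inv_W_left[of g] by (metis comp_apply id_apply)

lemma inv_W_right_apply: "tree_aut g \<Longrightarrow> g ((inv\<^bsub>W\<^esub> g) v) = v"
  using inv_W_right[of g] by (metis comp_apply id_apply)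

lemma portrait_inv: "tree_aut g \<Longrightarrow> portrait (inv\<^bsub>W\<^esub> g) (g v) = portrait g v"
  using portrait_comp[of "inv\<^bsub>W\<^esub> g" g v] inv_W_left[of g]
  by (cases "portrait g v"; cases "portrait (inv\<^bsub>W\<^esub> g) (g v)") simp_all

section \<open>Automorphisms acting below one vertex\<close>

lemma below_Nil [simp]: "below [] g = g"
  by (auto simp: below_def)

lemma below_singleton_simps:
  "below [x] g [] = []" "below [x] g (b # w) = (if b = x then b # g w else b # w)"
  by (auto simp: below_def)

lemma below_Cons: "below (x # v) g = below [x] (below v g)"
proof
  fix u show "below (x # v) g u = below [x] (below v g) u"
    by (cases u) (auto simp: below_def)
qed

lemma below_comp: "below [x] (g \<circ> h) = below [x] g \<circ> below [x] h"
proof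
  fix u show "below [x] (g \<circ> h) u = (below [x] g \<circ> below [x] h) u"
    by (cases u) (auto simp: below_singleton_simps)
qed

lemma below_id: "below [x] id = id"
proof
  fix u show "below [x] id u = id u"
    by (cases u) (auto simp: below_singleton_simps)
qed

lemma portrait_below:
  assumes g: "tree_aut g"
  shows "portrait (below [x] g) [] = 0"
    and "portrait (below [x] g) (b # w) = (if b = x then portrait g w else 0)"
  using tree_aut_snoc[OF g, of w False]
  by (auto simp: portrait_def below_singleton_simps tree_aut_Nil[OF g])

lemma tree_aut_below_singleton [simp]:
  assumes g: "tree_aut g"
  shows "tree_aut (below [x] g)"
proof (rule tree_autI)
  show "length (below [x] g u) = length u" for u
    by (cases u) (auto simp: below_singleton_simps tree_aut_length[OF g])
  show "prefix (below [x] g u) (below [x] g v)" if "prefix u v" for u v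
    using that
    by (cases u; cases v) (auto simp: below_singleton_simps intro: tree_aut_prefix[OF g])
  show "inj (below [x] g)"
  proof (rule injI)
    fix u v assume "below [x] g u = below [x] g v"
    then show "u = v"
      using tree_aut_inj[OF g]
      by (cases u; cases v) (auto simp: below_singleton_simps split: if_splits dest: injD)
  qed
qed

lemma tree_aut_below [simp]: "tree_aut g \<Longrightarrow> tree_aut (below v g)"
proof (induction v)
  case (Cons x v)
  then show ?case by (subst below_Cons) simp
qed simp

lemma sigma_simps [simp]: "sigma [] = []" "sigma (b # w) = (\<not> b) # w"
  by (simp_all add: sigma_def)

lemma tree_aut_sigma [simp]: "tree_aut sigma"
proof (rule tree_autI)
  show "length (sigma u) = length u" for u by (cases u) auto
  show "prefix (sigma u) (sigma v)" if "prefix u v" for u v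
    using that by (cases u; cases v) auto
  show "inj sigma"
  proof (rule injI)
    fix u v assume "sigma u = sigma v"
    then show "u = v" by (cases u; cases v) auto
  qed
qed

section \<open>The finitary group\<close>

lemma subgroup_finitary: "subgroup finitary W"
  unfolding finitary_def by (rule W.generate_is_subgroup) auto

lemma finitary_tree_aut [simp]: "f \<in> finitary \<Longrightarrow> tree_aut f"
  using subgroup.mem_carrier[OF subgroup_finitary, of f] by simp

lemma finitary_comp: "f \<in> finitary \<Longrightarrow> g \<in> finitary \<Longrightarrow> f \<circ> g \<in> finitary"
  using subgroup.m_closed[OF subgroup_finitary, of f g] by simp

lemma finitary_below_sigma: "below v sigma \<in> finitary"
  unfolding finitary_def by (rule generate.incl) auto

lemma inv_below: "tree_aut g \<Longrightarrow> inv\<^bsub>W\<^esub> (below [x] g) = below [x] (inv\<^bsub>W\<^esub> g)"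
  using W.inv_equality[of "below [x] (inv\<^bsub>W\<^esub> g)" "below [x] g"]
  by (simp add: below_comp[symmetric] inv_W_left below_id)

text \<open>Since \<open>below [x]\<close> is a homomorphism, it is enough to treat
  generators.\<close>

lemma generate_below:
  assumes S: "\<And>g. g \<in> S \<Longrightarrow> tree_aut g" and T: "\<And>g. g \<in> S \<Longrightarrow> below [x] g \<in> generate W T"
    and "T \<subseteq> carrier W" and "g \<in> generate W S"
  shows "below [x] g \<in> generate W T"
  using assms(4)
proof induction
  case one
  then show ?case using generate.one[of W T] by (metis W_simps(3) below_id)
next
  case (inv h)
  then show ?case using W.generate_m_inv_closed[OF assms(3) T] by (simp add: inv_below S)
next
  case (eng g h)
  then show ?case using generate.eng[of _ W T] by (metis W_simps(2) below_comp)
qed (rule T)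

lemma finitary_below:
  assumes "f \<in> finitary" shows "below [x] f \<in> finitary"
  unfolding finitary_def
proof (rule generate_below)
  show "f \<in> generate W {below v sigma |v. True}" using assms by (simp add: finitary_def)
  show "below [x] g \<in> generate W {below v sigma |v. True}" if "g \<in> {below v sigma |v. True}" for g
    using that finitary_below_sigma unfolding finitary_def[symmetric]
    by (auto simp flip: below_Cons)
qed auto

text \<open>The portrait of \<open>g\<close> is cut off at level \<open>K\<close>. Recursively,
  truncations of the two sections are hung below the children of the root, and \<open>r\<close>
  supplies the flip at the root.\<close>

lemma finitary_approx:
  assumes "tree_aut g"
  obtains f where "f \<in> finitary" "\<And>v. length v \<le> K \<Longrightarrow> f v = g v"
    "\<And>v. K \<le> length v \<Longrightarrow> portrait f v = 0"
proof -
  have "\<exists>f\<in>finitary. (\<forall>v. length v \<le> K \<longrightarrow> f v = g v) \<and> (\<forall>v. K \<le> length v \<longrightarrow> portrait f v = 0)"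
    using assms
  proof (induction K arbitrary: g)
    case 0
    have "id \<in> finitary" using subgroup.one_closed[OF subgroup_finitary] by simp
    then show ?case by (rule bexI[rotated]) (simp add: tree_aut_Nil[OF 0])
  next
    case (Suc K)
    have "\<forall>b. \<exists>f\<in>finitary. (\<forall>v. length v \<le> K \<longrightarrow> f v = section_at g b v) \<and>
        (\<forall>v. K \<le> length v \<longrightarrow> portrait f v = 0)"
      using Suc.IH tree_aut_section[OF Suc.prems] by blast
    then obtain f where f: "\<And>b. f b \<in> finitary" "\<And>b v. length v \<le> K \<Longrightarrow> f b v = section_at g b v"
      "\<And>b v. K \<le> length v \<Longrightarrow> portrait (f b) v = 0" by metis
    define r where "r = (if portrait g [] = 0 then id else sigma)"
    define F where "F = r \<circ> (below [False] (f False) \<circ> below [True] (f True))"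
    have "r \<in> finitary"
      using finitary_below_sigma[of "[]"] subgroup.one_closed[OF subgroup_finitary]
      by (simp add: r_def)
    then have "F \<in> finitary"
      unfolding F_def by (intro finitary_comp finitary_below f)
    moreover have F: "F (b # w) = (b = (portrait g [] = 0)) # f b w" for b w
      by (cases b) (auto simp: F_def r_def below_singleton_simps)
    have "F v = g v" if "length v \<le> Suc K" for v
    proof (cases v)
      case Nil
      then show ?thesis
        using tree_aut_Nil[OF Suc.prems] tree_aut_Nil[OF finitary_tree_aut[OF calculation(1)]] by simp
    qed (use that in \<open>simp add: F f tree_aut_Cons[OF Suc.prems]\<close>)
    moreover have "portrait F v = 0" if "Suc K \<le> length v" for v
    proof (cases v)
      case (Cons b w)
      have "f b (w @ [False]) \<noteq> []"
        using tree_aut_length[OF finitary_tree_aut[OF f(1)], of b "w @ [False]"] by force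
      then have "portrait F v = portrait (f b) w"
        by (simp add: portrait_def F Cons)
      then show ?thesis using that Cons f by simp
    qed (use that in simp)
    ultimately show ?case by blast
  qed
  then show thesis using that by blast
qed

lemma finitary_portrait:
  assumes "f \<in> finitary"
  obtains K where "\<And>v. K \<le> length v \<Longrightarrow> portrait f v = 0"
proof -
  let ?P = "\<lambda>f. \<exists>K. \<forall>v. K \<le> length v \<longrightarrow> portrait f v = 0"
  have below: "?P (below v sigma)" for v
  proof (induction v)
    case Nil
    have "portrait sigma v = 0" if "1 \<le> length v" for v
      using that by (cases v) (auto simp: portrait_def)
    then show ?case by auto
  next
    case (Cons x v)
    then obtain K where K: "\<forall>u. K \<le> length u \<longrightarrow> portrait (below v sigma) u = 0" by blast
    have "portrait (below (x # v) sigma) u = 0" if "Suc K \<le> length u" for u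
      using that K by (subst below_Cons) (cases u; auto simp: portrait_below)
    then show ?case by blast
  qed
  have inv: "?P (inv\<^bsub>W\<^esub> g)" if P: "?P g" and g: "tree_aut g" for g
  proof -
    obtain K where K: "\<forall>u. K \<le> length u \<longrightarrow> portrait g u = 0" using P by blast
    have "portrait (inv\<^bsub>W\<^esub> g) u = 0" if "K \<le> length u" for u
      using portrait_inv[OF g, of "(inv\<^bsub>W\<^esub> g) u"] K that g
      by (simp add: inv_W_right_apply tree_aut_length)
    then show ?thesis by blast
  qed
  have "?P f"
    using assms unfolding finitary_def
  proof induction
    case (eng g h)
    have t: "tree_aut g" "tree_aut h"
      using eng.hyps unfolding finitary_def[symmetric] by simp_all
    note len = tree_aut_length[OF t(2)]
    obtain K L where "\<forall>u. K \<le> length u \<longrightarrow> portrait g u = 0" "\<forall>u. L \<le> length u \<longrightarrow> portrait h u = 0"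
      using eng.IH by blast
    then have "\<forall>u. max K L \<le> length u \<longrightarrow> portrait (g \<circ> h) u = 0"
      by (simp add: portrait_comp t len)
    then show ?case unfolding W_simps by blast
  qed (use below inv in auto)
  then show thesis using that by blast
qed

text \<open>Once the parent is in place, \<open>below v' sigma\<close> corrects the last letter
  without moving \<open>v'\<close>.\<close>

lemma finitary_transitive:
  "length u = length v \<Longrightarrow> \<exists>f\<in>finitary. f u = v"
proof (induction u arbitrary: v rule: rev_induct)
  case Nil
  then show ?case using subgroup.one_closed[OF subgroup_finitary] by (auto intro: bexI[of _ id])
next
  case (snoc b u)
  then obtain v' c where v: "v = v' @ [c]" "length v' = length u"
    by (metis append_butlast_last_id length_append_singleton length_butlast diff_Suc_1
        length_0_conv nat.distinct(1))
  then obtain f where f: "f \<in> finitary" "f u = v'" using snoc.IH by metis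
  then obtain d where d: "f (u @ [b]) = v' @ [d]" by (simp add: tree_aut_snoc)
  show ?case
  proof (cases "d = c")
    case True
    then show ?thesis using f d v by auto
  next
    case False
    then have "(below v' sigma \<circ> f) (u @ [b]) = v" by (auto simp: d v below_def)
    then show ?thesis using finitary_comp[OF finitary_below_sigma f(1)] by blast
  qed
qed

section \<open>Polynomial functions on a level\<close>

text \<open>Reading a vertex as a binary number with least significant digit first, \<open>dmon j v\<close>
  is the binomial coefficient of \<open>v\<close> over \<open>j\<close> modulo 2 (Lucas).\<close>

fun dmon :: "nat \<Rightarrow> bool list \<Rightarrow> bit" where
  "dmon j [] = of_bool (j = 0)"
| "dmon j (b # w) = (if even j \<or> b then dmon (j div 2) w else 0)"

definition pol :: "nat \<Rightarrow> nat \<Rightarrow> (bool list \<Rightarrow> bit) \<Rightarrow> bool" where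
  "pol d k p \<longleftrightarrow> (\<exists>c. \<forall>v. length v = k \<longrightarrow> p v = (\<Sum>j<d. c j * dmon j v))"

lemma pol_cong: "pol d k p \<Longrightarrow> (\<And>v. length v = k \<Longrightarrow> q v = p v) \<Longrightarrow> pol d k q"
  unfolding pol_def by metis

lemma pol_zero: "pol d k (\<lambda>v. 0)"
  unfolding pol_def by (rule exI[of _ "\<lambda>_. 0"]) simp

lemma pol_add:
  assumes "pol d k p" "pol d k q" shows "pol d k (\<lambda>v. p v + q v)"
proof -
  obtain a b where "\<forall>v. length v = k \<longrightarrow> p v = (\<Sum>j<d. a j * dmon j v)"
    "\<forall>v. length v = k \<longrightarrow> q v = (\<Sum>j<d. b j * dmon j v)"
    using assms unfolding pol_def by blast
  then show ?thesis unfolding pol_def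
    by (intro exI[of _ "\<lambda>j. a j + b j"]) (simp add: distrib_right sum.distrib)
qed

lemma pol_scale:
  assumes "pol d k p" shows "pol d k (\<lambda>v. s * p v)"
  using assms by (cases s) (simp_all add: pol_zero)

lemma pol_sum: "(\<And>i. i \<in> A \<Longrightarrow> pol d k (p i)) \<Longrightarrow> pol d k (\<lambda>v. \<Sum>i\<in>A. p i v)"
  by (induction A rule: infinite_finite_induct) (auto intro: pol_zero pol_add)

lemma pol_dmon: "j < d \<Longrightarrow> pol d k (dmon j)"
  unfolding pol_def by (rule exI[of _ "\<lambda>i. of_bool (i = j)"]) (simp add: of_bool_def if_distrib
    [of "\<lambda>x. x * _"] sum.delta cong: if_cong)

lemma pol_mono:
  assumes "pol d k p" "d \<le> e" shows "pol e k p"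
proof -
  obtain c where c: "\<And>v. length v = k \<Longrightarrow> p v = (\<Sum>j<d. c j * dmon j v)"
    using assms(1) unfolding pol_def by blast
  have "pol e k (\<lambda>v. \<Sum>j<d. c j * dmon j v)"
    using assms(2) by (intro pol_sum pol_scale pol_dmon) auto
  then show ?thesis by (rule pol_cong) (rule c)
qed

text \<open>Even indices ignore the first letter and read the tail at half the index, so the largest
  index becomes \<open>2 * (e - 1)\<close>.\<close>

lemma pol_tl:
  assumes "pol e k p" shows "pol (2 * e - 1) (Suc k) (\<lambda>v. p (tl v))"
proof -
  obtain c where c: "\<And>v. length v = k \<Longrightarrow> p v = (\<Sum>j<e. c j * dmon j v)"
    using assms unfolding pol_def by blast
  have "pol (2 * e - 1) (Suc k) (\<lambda>v. \<Sum>j<e. c j * dmon (2 * j) v)"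
    by (intro pol_sum pol_scale pol_dmon) auto
  then show ?thesis
    by (rule pol_cong) (auto simp: length_Suc_conv c)
qed

lemma pol_hd_mult_tl:
  assumes "pol e k p" shows "pol (2 * e) (Suc k) (\<lambda>v. of_bool (hd v) * p (tl v))"
proof -
  obtain c where c: "\<And>v. length v = k \<Longrightarrow> p v = (\<Sum>j<e. c j * dmon j v)"
    using assms unfolding pol_def by blast
  have "pol (2 * e) (Suc k) (\<lambda>v. \<Sum>j<e. c j * dmon (Suc (2 * j)) v)"
    by (intro pol_sum pol_scale pol_dmon) auto
  then show ?thesis
    by (rule pol_cong) (auto simp: length_Suc_conv c)
qed

text \<open>Every function is affine in the first letter, with coefficients that are functions of
  the tail and fall under the induction hypothesis.\<close>

lemma pol_all: "pol (2 ^ k) k p"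
proof (induction k arbitrary: p)
  case 0
  have "pol 1 0 (\<lambda>v. p [] * dmon 0 v)" by (intro pol_scale pol_dmon) simp
  then have "pol 1 0 p" by (rule pol_cong) simp
  then show ?case by simp
next
  case (Suc k)
  have "pol (2 * 2 ^ k) (Suc k) (\<lambda>v. p (False # tl v) +
      of_bool (hd v) * (p (False # tl v) + p (True # tl v)))"
    using pol_tl[OF Suc[of "\<lambda>v. p (False # v)"]]
      pol_hd_mult_tl[OF Suc[of "\<lambda>v. p (False # v) + p (True # v)"]]
    by (intro pol_add) (auto elim: pol_mono)
  then have "pol (2 * 2 ^ k) (Suc k) p"
    by (rule pol_cong) (auto simp: length_Suc_conv)
  then show ?case by simp
qed

text \<open>Unipotence of the action, by splitting off the first letter: the sections act on the
  tail, where the induction hypothesis controls the errors \<open>q\<close>, and the root flip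
  \<open>s\<close> is tracked separately.\<close>

lemma pol_dmon_diff:
  assumes "tree_aut h" shows "pol d k (\<lambda>v. dmon d (h v) + dmon d v)"
  using assms
proof (induction k arbitrary: h d)
  case 0
  show ?case by (rule pol_cong[OF pol_zero]) (simp add: tree_aut_Nil[OF 0])
next
  case (Suc k)
  note h = tree_aut_Cons[OF Suc.prems]
  define e where "e = d div 2"
  define s where "s = portrait h []"
  define q where "q b w = dmon e (section_at h b w) + dmon e w" for b w
  have q: "pol e k (q b)" for b
    unfolding q_def by (rule Suc.IH[OF tree_aut_section[OF Suc.prems]])
  have dq: "dmon e (section_at h b w) = dmon e w + q b w" for b w
    by (simp add: q_def add.commute[of "dmon e w"] add.assoc)
  show ?case
  proof (cases "even d")
    case True
    then have d: "d = 2 * e" by (simp add: e_def)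
    \<comment> \<open>An even index does not see the root flip, so the difference is
      \<open>q b w\<close>, interpolated here between the two values of \<open>b\<close>.\<close>
    have "pol (2 * e) (Suc k) (\<lambda>v. q False (tl v) +
        of_bool (hd v) * (q False (tl v) + q True (tl v)))"
      by (intro pol_add pol_hd_mult_tl pol_mono[OF pol_tl[OF q]] q) simp
    then have "pol (2 * e) (Suc k) (\<lambda>v. dmon d (h v) + dmon d v)"
      by (rule pol_cong) (auto simp: length_Suc_conv h d dq add.assoc add.left_commute)
    then show ?thesis using d by simp
  next
    case False
    then have d: "d = Suc (2 * e)" by (simp add: e_def)
    \<comment> \<open>With \<open>b\<close> read as a bit, the difference is now
      \<open>s * dmon e w + (b + s) * q b w\<close>; its first term is \<open>s\<close> times the
      basis function of index \<open>2 * e\<close>, one below \<open>d\<close>.\<close>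
    have "pol (2 * e) (Suc k) (\<lambda>v. of_bool (hd v) *
        (s * q False (tl v) + (1 + s) * q True (tl v)))"
      by (rule pol_hd_mult_tl) (intro pol_add pol_scale q)
    then have "pol d (Suc k) (\<lambda>v. s * dmon (2 * e) v + s * q False (tl v) +
        of_bool (hd v) * (s * q False (tl v) + (1 + s) * q True (tl v)))"
      by (intro pol_add pol_scale pol_dmon pol_mono[OF pol_tl[OF q]])
        (auto simp: d elim: pol_mono)
    then show ?thesis
      by (rule pol_cong) (cases s; auto simp: length_Suc_conv h d dq s_def[symmetric] add.assoc
          add.left_commute)
  qed
qed

lemma pol_diff:
  assumes "tree_aut h" "pol (Suc d) k p" shows "pol d k (\<lambda>v. p (h v) + p v)"
proof -
  obtain c where c: "\<And>v. length v = k \<Longrightarrow> p v = (\<Sum>j<Suc d. c j * dmon j v)"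
    using assms(2) unfolding pol_def by blast
  have "pol d k (\<lambda>v. \<Sum>j<Suc d. c j * (dmon j (h v) + dmon j v))"
    by (intro pol_sum pol_scale pol_mono[OF pol_dmon_diff[OF assms(1)]]) auto
  then show ?thesis
    by (rule pol_cong)
      (simp add: c tree_aut_length[OF assms(1)] distrib_left sum.distrib del: sum.lessThan_Suc)
qed

lemma pol_comp:
  assumes "tree_aut h" "pol d k p" shows "pol d k (\<lambda>v. p (h v))"
proof -
  have "pol d k (\<lambda>v. (p (h v) + p v) + p v)"
    by (intro pol_add pol_diff[OF assms(1)] pol_mono[OF assms(2)] assms(2)) simp
  then show ?thesis by (rule pol_cong) (simp add: add.assoc)
qed

text \<open>An index below \<open>2 ^ K\<close> has at most \<open>K\<close> binary digits, and a
  digit 0 puts no condition on its letter.\<close>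

lemma dmon_take: "j < 2 ^ K \<Longrightarrow> dmon j (take K v) = dmon j v"
proof (induction K arbitrary: j v)
  case 0
  have "dmon 0 v = 1" by (induction v) auto
  then show ?case using 0 by simp
next
  case (Suc K)
  then show ?case by (cases v) auto
qed

section \<open>Annihilators\<close>

definition orth :: "nat \<Rightarrow> nat \<Rightarrow> (bool list \<Rightarrow> bool list) \<Rightarrow> bool" where
  "orth d k g \<longleftrightarrow> (\<forall>j<d. (\<Sum>v | length v = k. portrait g v * dmon j v) = 0)"

lemma orth_pol:
  assumes "orth d k g" "pol d k p"
  shows "(\<Sum>v | length v = k. portrait g v * p v) = 0"
proof -
  obtain c where c: "\<And>v. length v = k \<Longrightarrow> p v = (\<Sum>j<d. c j * dmon j v)"
    using assms(2) unfolding pol_def by blast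
  have "(\<Sum>v | length v = k. portrait g v * p v)
      = (\<Sum>v | length v = k. \<Sum>j<d. c j * (portrait g v * dmon j v))"
    by (rule sum.cong) (simp_all add: c sum_distrib_left mult.left_commute)
  also have "\<dots> = (\<Sum>j<d. c j * (\<Sum>v | length v = k. portrait g v * dmon j v))"
    by (subst sum.swap) (simp add: sum_distrib_left)
  also have "\<dots> = 0" using assms(1) by (simp add: orth_def)
  finally show ?thesis .
qed

lemma orthI:
  assumes "\<And>p. pol d k p \<Longrightarrow> (\<Sum>v | length v = k. portrait g v * p v) = 0"
  shows "orth d k g"
  unfolding orth_def using assms pol_dmon by blast

lemma orth_portrait_0: "(\<And>v. length v = k \<Longrightarrow> portrait g v = 0) \<Longrightarrow> orth d k g"
  by (simp add: orth_def)

text \<open>On such a shallow level the span contains all functions, so pairing with the indicator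
  of \<open>u\<close> reads off the value there.\<close>

lemma orth_full:
  assumes "orth d k g" "2 ^ k \<le> d" "length u = k"
  shows "portrait g u = 0"
proof -
  have "(\<Sum>v | length v = k. portrait g v * of_bool (v = u)) = 0"
    by (rule orth_pol[OF assms(1) pol_mono[OF pol_all assms(2)]])
  then show ?thesis
    using assms(3) by (simp add: of_bool_def if_distrib[of "\<lambda>x. _ * x"] sum.delta cong: if_cong)
qed

text \<open>By the cocycle rule one summand is shifted by \<open>h\<close>; reindexing the level
  moves the shift to the test function, and the span is invariant.\<close>

lemma orth_comp:
  assumes g: "tree_aut g" and h: "tree_aut h" and "orth d k g" "orth d k h"
  shows "orth d k (g \<circ> h)"
proof (rule orthI)
  fix p assume p: "pol d k p"
  obtain i where i: "tree_aut i" "\<And>v. i (h v) = v" "\<And>v. h (i v) = v"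
    by (rule tree_aut_inv[OF h], rule that)
  have "(\<Sum>v | length v = k. portrait g (h v) * p (i (h v))) = 0"
    using sum_level_tree_aut[OF h, of "\<lambda>v. portrait g v * p (i v)" k]
      orth_pol[OF assms(3) pol_comp[OF i(1) p]] by simp
  then show "(\<Sum>v | length v = k. portrait (g \<circ> h) v * p v) = 0"
    using orth_pol[OF assms(4) p] by (simp add: portrait_comp[OF g h] distrib_right sum.distrib i(2))
qed

lemma orth_inv:
  assumes g: "tree_aut g" and "orth d k g"
  shows "orth d k (inv\<^bsub>W\<^esub> g)"
proof (rule orthI)
  fix p assume p: "pol d k p"
  show "(\<Sum>v | length v = k. portrait (inv\<^bsub>W\<^esub> g) v * p v) = 0"
    using sum_level_tree_aut[OF g, of "\<lambda>v. portrait (inv\<^bsub>W\<^esub> g) v * p v" k]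
      orth_pol[OF assms(2) pol_comp[OF g p]] by (simp add: portrait_inv[OF g])
qed

text \<open>With \<open>K\<close> least such that \<open>d < 2 ^ K\<close>, every level below
  \<open>K\<close> is shallow enough for \<open>orth_full\<close>. So \<open>g\<close> fixes the
  first \<open>K\<close> letters, and the basis functions of index at most \<open>d\<close> see no
  others.\<close>

lemma orth_fixes_pol:
  assumes g: "tree_aut g" and o: "\<And>l. l < k \<Longrightarrow> orth d l g"
    and p: "pol (Suc d) k p" and v: "length v = k"
  shows "p (g v) = p v"
proof -
  define K where "K = (LEAST K. d < (2 :: nat) ^ K)"
  have K: "d < 2 ^ K" unfolding K_def by (rule LeastI[of _ d]) simp
  have "portrait g u = 0" if "length u < length (take K v)" for u
  proof (rule orth_full)
    have "length u < K" using that by simp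
    then show "2 ^ length u \<le> d" unfolding K_def using not_less_Least not_less by blast
  qed (use that v o in auto)
  then have "g (take K v) = take K v" by (rule tree_aut_fixes_level[OF g])
  then have "take K (g v) = take K v" by (simp add: tree_aut_take[OF g])
  then have m: "dmon j (g v) = dmon j v" if "j < Suc d" for j
    using dmon_take[of j K] K that by (metis less_Suc_eq_le le_less_trans)
  obtain c where "\<And>v. length v = k \<Longrightarrow> p v = (\<Sum>j<Suc d. c j * dmon j v)"
    using p unfolding pol_def by blast
  then show ?thesis using m v by (simp add: tree_aut_length[OF g])
qed

text \<open>The relation \<open>c \<circ> (h \<circ> g) = g \<circ> h\<close> is the inverse-free form of \<open>c = [g, h]\<close>.\<close>

lemma portrait_commutator:
  assumes g: "tree_aut g" and h: "tree_aut h" and c: "tree_aut c" and "c \<circ> (h \<circ> g) = g \<circ> h"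
  shows "portrait c (h (g v)) = (portrait h v + portrait h (g v)) + (portrait g v + portrait g (h v))"
proof -
  have "portrait (c \<circ> (h \<circ> g)) v = portrait (g \<circ> h) v" using assms(4) by simp
  then have "portrait g v + portrait h (g v) + portrait c (h (g v)) = portrait h v + portrait g (h v)"
    using g h c by (simp add: portrait_comp)
  then show ?thesis
    by (cases "portrait g v"; cases "portrait h v"; cases "portrait h (g v)";
        cases "portrait g (h v)"; cases "portrait c (h (g v))") simp_all
qed

text \<open>The portrait of \<open>c\<close> is known at \<open>h (g v)\<close>. Reindexing the
  level by \<open>h \<circ> g\<close> permutes the test functions of the span, so the criterion can
  be stated at \<open>v\<close>.\<close>

lemma orth_iff_commutator:
  assumes g: "tree_aut g" and h: "tree_aut h" and c: "tree_aut c" and "c \<circ> (h \<circ> g) = g \<circ> h"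
  shows "orth d k c \<longleftrightarrow> (\<forall>q. pol d k q \<longrightarrow>
    (\<Sum>v | length v = k. ((portrait h v + portrait h (g v)) + (portrait g v + portrait g (h v))) * q v) = 0)"
    (is "_ \<longleftrightarrow> (\<forall>q. _ \<longrightarrow> ?S q = 0)")
proof -
  have S: "?S (\<lambda>v. p (h (g v))) = (\<Sum>v | length v = k. portrait c v * p v)" for p
    using sum_level_tree_aut[OF tree_aut_comp[OF h g], of "\<lambda>v. portrait c v * p v" k]
    by (simp add: portrait_commutator[OF assms])
  obtain i where i: "tree_aut i" "\<And>v. i ((h \<circ> g) v) = v" "\<And>v. (h \<circ> g) (i v) = v"
    by (rule tree_aut_inv[OF tree_aut_comp[OF h g]], rule that)
  show ?thesis
  proof safe
    fix q assume "orth d k c" "pol d k q"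
    then have "(\<Sum>v | length v = k. portrait c v * q (i v)) = 0"
      using orth_pol[OF _ pol_comp[OF i(1)]] by blast
    then show "?S q = 0" using S[of "\<lambda>v. q (i v)"] i(2) by simp
  next
    assume *: "\<forall>q. pol d k q \<longrightarrow> ?S q = 0"
    show "orth d k c"
    proof (rule orthI)
      fix p assume "pol d k p"
      then have "pol d k (\<lambda>v. p (h (g v)))" using pol_comp[OF tree_aut_comp[OF h g]] by simp
      then show "(\<Sum>v | length v = k. portrait c v * p v) = 0"
        unfolding S[symmetric] using * by blast
    qed
  qed
qed

text \<open>The test function \<open>q\<close> is invariant under \<open>g\<close>, so both halves
  of the sum agree and cancel modulo 2.\<close>

lemma sum_portrait_shift_0:
  assumes g: "tree_aut g" and o: "\<And>l. l < k \<Longrightarrow> orth d l g" and q: "pol (Suc d) k q"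
  shows "(\<Sum>v | length v = k. (f v + f (g v)) * q v) = 0"
proof -
  have "(\<Sum>v | length v = k. f (g v) * q v) = (\<Sum>v | length v = k. f (g v) * q (g v))"
    by (rule sum.cong) (simp_all add: orth_fixes_pol[OF g o q])
  also have "\<dots> = (\<Sum>v | length v = k. f v * q v)"
    by (rule sum_level_tree_aut[OF g])
  finally show ?thesis by (simp add: distrib_right sum.distrib)
qed

text \<open>Summation by parts: level sums are invariant under \<open>h\<close>, and signs disappear
  in characteristic 2.\<close>

lemma sum_shift_by_parts:
  fixes f q :: "bool list \<Rightarrow> bit"
  assumes h: "tree_aut h"
  shows "(\<Sum>v | length v = k. (f v + f (h v)) * q (h v)) = (\<Sum>v | length v = k. f v * (q (h v) + q v))"
  using sum_level_tree_aut[OF h, of "\<lambda>v. f v * q v" k]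
  by (simp add: distrib_right distrib_left sum.distrib)

lemma sum_add_mult:
  fixes f f' q :: "'a \<Rightarrow> bit"
  shows "(\<Sum>v\<in>A. (f v + f' v) * q v) = (\<Sum>v\<in>A. f v * q v) + (\<Sum>v\<in>A. f' v * q v)"
  by (simp only: distrib_right sum.distrib)

text \<open>The terms with the portrait of \<open>h\<close> cancel because \<open>g\<close> fixes
  \<open>q\<close>. In the others, summation by parts turns the difference of the portrait of
  \<open>g\<close> into a difference of \<open>?q\<close>, which has dropped into the span for
  \<open>d\<close>.\<close>

lemma orth_commutator:
  assumes g: "tree_aut g" and h: "tree_aut h" and c: "tree_aut c" and "c \<circ> (h \<circ> g) = g \<circ> h"
    and o: "\<And>l. l \<le> k \<Longrightarrow> orth d l g"
  shows "orth (Suc d) k c"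
proof (rule orth_iff_commutator[OF g h c assms(4), THEN iffD2], intro allI impI)
  fix q assume q: "pol (Suc d) k q"
  obtain i where i: "tree_aut i" "\<And>v. i (h v) = v" "\<And>v. h (i v) = v"
    by (rule tree_aut_inv[OF h], rule that)
  let ?q = "\<lambda>v. q (i v)"
  have "pol d k (\<lambda>v. ?q (h v) + ?q v)"
    by (rule pol_diff[OF h pol_comp[OF i(1) q]])
  then have "(\<Sum>v | length v = k. portrait g v * (?q (h v) + ?q v)) = 0"
    by (rule orth_pol[OF o[OF order_refl]])
  then have "(\<Sum>v | length v = k. (portrait g v + portrait g (h v)) * q v) = 0"
    using sum_shift_by_parts[OF h, of "portrait g" ?q k] i(2) by simp
  then show "(\<Sum>v | length v = k. ((portrait h v + portrait h (g v)) +
      (portrait g v + portrait g (h v))) * q v) = 0"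
    using sum_portrait_shift_0[OF g o q, of "portrait h"]
    by (subst sum_add_mult) simp
qed

lemma sum_level_Suc:
  fixes f :: "bool list \<Rightarrow> bit"
  shows "(\<Sum>v | length v = Suc k. f v) = (\<Sum>w | length w = k. f (False # w) + f (True # w))"
proof -
  let ?L = "{w :: bool list. length w = k}"
  have "{v :: bool list. length v = Suc k} = Cons False ` ?L \<union> Cons True ` ?L"
    by (auto simp: length_Suc_conv)
  then have "(\<Sum>v | length v = Suc k. f v) = sum f (Cons False ` ?L \<union> Cons True ` ?L)"
    by (rule arg_cong)
  also have "\<dots> = sum f (Cons False ` ?L) + sum f (Cons True ` ?L)"
    by (rule sum.union_disjoint) auto
  finally show ?thesis by (simp add: sum.reindex sum.distrib)
qed

section \<open>The odometer\<close>

fun odometer :: "bool list \<Rightarrow> bool list" where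
  "odometer [] = []"
| "odometer (b # w) = (\<not> b) # (if b then odometer w else w)"

fun lsb_val :: "bool list \<Rightarrow> nat" where
  "lsb_val [] = 0"
| "lsb_val (b # w) = of_bool b + 2 * lsb_val w"

lemma tree_aut_odometer [simp]: "tree_aut odometer"
proof (rule tree_autI)
  show "length (odometer u) = length u" for u by (induction u) auto
  show "prefix (odometer u) (odometer v)" if "prefix u v" for u v
    using that
  proof (induction u arbitrary: v)
    case (Cons b u)
    then show ?case by (cases v) auto
  qed simp
  have "odometer u = odometer v \<Longrightarrow> u = v" for u v
  proof (induction u arbitrary: v)
    case Nil
    then show ?case by (cases v) auto
  next
    case (Cons b u)
    then show ?case by (cases v) (auto split: if_splits)
  qed
  then show "inj odometer" by (rule injI)
qed

text \<open>On each level the carry reaches the next letter from exactly one vertex, the one with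
  all letters \<open>True\<close>.\<close>

lemma sum_portrait_odometer: "(\<Sum>v | length v = k. portrait odometer v) = 1"
proof (induction k)
  case 0
  then show ?case by (simp add: portrait_def)
next
  case (Suc k)
  have "odometer (w @ [False]) \<noteq> []" for w by (cases w) auto
  then have "portrait odometer (b # w) = of_bool b * portrait odometer w" for b w
    by (simp add: portrait_def)
  then show ?case using Suc by (simp add: sum_level_Suc)
qed

text \<open>Pascal's rule; the bound on \<open>Suc j\<close> takes care of the wrap-around from the
  all-\<open>True\<close> vertex to zero.\<close>

lemma dmon_odometer:
  "Suc j < 2 ^ length v \<Longrightarrow> dmon (Suc j) (odometer v) = dmon (Suc j) v + dmon j v"
proof (induction v arbitrary: j)
  case (Cons b w)
  show ?case
  proof (cases "even j")
    case False
    then obtain i where "j = Suc (2 * i)" by (auto elim: oddE)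
    then show ?thesis using Cons by simp
  qed (auto simp: even_Suc_div_two)
qed simp

lemma lsb_val_less: "lsb_val w < 2 ^ length w"
  by (induction w) auto

lemma lsb_val_inj: "length u = length v \<Longrightarrow> lsb_val u = lsb_val v \<Longrightarrow> u = v"
proof (induction u v rule: list_induct2)
  case (Cons a u b v)
  then have "a = b" by (cases a; cases b; simp; presburger)
  then show ?case using Cons by simp
qed simp

lemma lsb_val_append: "lsb_val (u @ v) = lsb_val u + 2 ^ length u * lsb_val v"
  by (induction u) (auto simp: algebra_simps)

lemma lsb_val_odometer: "lsb_val (odometer w) = Suc (lsb_val w) mod 2 ^ length w"
proof (induction w)
  case (Cons b w)
  show ?case
  proof (cases b)
    case True
    have "Suc (lsb_val (b # w)) mod 2 ^ length (b # w) = (2 * Suc (lsb_val w)) mod (2 * 2 ^ length w)"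
      using True by simp
    also have "\<dots> = 2 * (Suc (lsb_val w) mod 2 ^ length w)" by (rule mult_mod_right[symmetric])
    finally show ?thesis using True Cons by simp
  next
    case False
    then show ?thesis using lsb_val_less[of w] by simp
  qed
qed simp

lemma odometer_power_lsb_val: "(odometer ^^ lsb_val u) (replicate (length u) False) = u"
proof (rule lsb_val_inj)
  have len: "length ((odometer ^^ n) w) = length w" for n w
    by (induction n) (simp_all add: tree_aut_length)
  then show "length ((odometer ^^ lsb_val u) (replicate (length u) False)) = length u" by simp
  have 0: "lsb_val (replicate k False) = 0" for k by (induction k) auto
  have "lsb_val ((odometer ^^ n) (replicate k False)) = n mod 2 ^ k" for n k
    by (induction n) (simp_all add: 0 lsb_val_odometer len mod_Suc_eq)
  then show "lsb_val ((odometer ^^ lsb_val u) (replicate (length u) False)) = lsb_val u"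
    using lsb_val_less[of u] by simp
qed

section \<open>Conjugates of the odometer\<close>

lemma tree_aut_funpow: "tree_aut h \<Longrightarrow> tree_aut (h ^^ n)"
  by (induction n) simp_all

lemma portrait_funpow:
  "tree_aut h \<Longrightarrow> portrait (h ^^ n) v = (\<Sum>i<n. portrait h ((h ^^ i) v))"
  by (induction n) (simp_all add: portrait_comp tree_aut_funpow)

text \<open>If the orbit of the zero vertex covers level \<open>k\<close>, the portrait of
  \<open>h ^^ (2 ^ k)\<close> at that vertex is the whole level sum 1. One round therefore flips the
  next letter, and the orbit doubles.\<close>

lemma level_cycle:
  assumes h: "tree_aut h" and sum: "\<And>k. (\<Sum>v | length v = k. portrait h v) = 1"
  shows "(h ^^ (2 ^ k)) (replicate k False) = replicate k False"
    and "inj_on (\<lambda>i. (h ^^ i) (replicate k False)) {..<2 ^ k}"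
proof -
  let ?z = "\<lambda>k. replicate k False"
  note hn = tree_aut_funpow[OF h]
  have "(h ^^ (2 ^ k)) (?z k) = ?z k \<and> inj_on (\<lambda>i. (h ^^ i) (?z k)) {..<2 ^ k}"
  proof (induction k)
    case 0
    then show ?case by (simp add: tree_aut_Nil[OF h] inj_on_def)
  next
    case (Suc k)
    let ?N = "2 ^ k :: nat"
    let ?f = "\<lambda>i. (h ^^ i) (?z k)"
    have img: "?f ` {..<?N} = {v. length v = k}"
      by (rule card_subset_eq)
        (use Suc in \<open>auto simp: tree_aut_length[OF hn] card_image card_lists_length_eq[of UNIV, simplified]\<close>)
    have "portrait (h ^^ ?N) (?z k) = (\<Sum>i<?N. portrait h (?f i))"
      by (rule portrait_funpow[OF h])
    also have "\<dots> = (\<Sum>v\<in>?f ` {..<?N}. portrait h v)"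
      using Suc by (simp add: sum.reindex)
    also have "\<dots> = 1" by (simp only: img sum)
    finally have flip: "(h ^^ ?N) (?z k @ [b]) = ?z k @ [\<not> b]" for b
      using Suc by (simp add: tree_aut_snoc[OF hn])
    have z: "?z (Suc k) = ?z k @ [False]" by (simp add: replicate_append_same)
    have per: "(h ^^ (?N + ?N)) (?z k @ [False]) = ?z k @ [False]"
      by (simp only: funpow_add comp_apply flip) simp
    have "i = j" if "i < 2 * ?N" "j < 2 * ?N" "i \<le> j"
      and eq: "(h ^^ i) (?z k @ [False]) = (h ^^ j) (?z k @ [False])" for i j
    proof (rule ccontr)
      assume "i \<noteq> j"
      have "(h ^^ i) (?z k) = (h ^^ j) (?z k)"
        using eq by (simp add: tree_aut_snoc[OF hn])
      then have "(h ^^ (i mod ?N)) (?z k) = (h ^^ (j mod ?N)) (?z k)"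
        using Suc by (simp add: funpow_mod_eq)
      then have "i mod ?N = j mod ?N"
        using Suc by (auto dest: inj_onD)
      then have "?N dvd j - i" using \<open>i \<le> j\<close> by (metis mod_eq_dvd_iff_nat)
      then obtain m where "j - i = ?N * m" by (elim dvdE)
      \<comment> \<open>A nonzero multiple of \<open>2 ^ k\<close> that is smaller than
        \<open>2 * 2 ^ k\<close> can only be \<open>2 ^ k\<close> itself.\<close>
      moreover from this have "m = 1"
        using that \<open>i \<noteq> j\<close> by (cases m; cases "m - 1") auto
      ultimately have "j = i + ?N" using \<open>i \<le> j\<close> by simp
      then have "(h ^^ i) (?z k @ [False]) = (h ^^ i) (?z k @ [True])"
        using eq flip[of False] by (simp add: funpow_add)
      then show False using injD[OF tree_aut_inj[OF hn]] by fastforce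
    qed
    then have "inj_on (\<lambda>i. (h ^^ i) (?z k @ [False])) {..<2 * ?N}"
      by (intro inj_onI) (metis lessThan_iff nle_le)
    then show ?case using per by (simp add: z mult_2 del: replicate_Suc)
  qed
  then show "(h ^^ (2 ^ k)) (?z k) = ?z k" "inj_on (\<lambda>i. (h ^^ i) (?z k)) {..<2 ^ k}" by auto
qed

text \<open>Both maps are cycles on every level, so \<open>x\<close> matches them step by step from
  the zero vertex: the vertex reached by \<open>n\<close> odometer steps goes to the one reached by
  \<open>n\<close> steps of \<open>h\<close>.\<close>

lemma conjugate_odometer:
  assumes h: "tree_aut h" and sum: "\<And>k. (\<Sum>v | length v = k. portrait h v) = 1"
  obtains x where "tree_aut x" "x \<circ> odometer = h \<circ> x"
    "\<And>k. x (replicate k False) = replicate k False"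
proof
  let ?z = "\<lambda>k. replicate k False"
  let ?x = "\<lambda>w. (h ^^ lsb_val w) (?z (length w))"
  note hn = tree_aut_funpow[OF h]
  have 0: "lsb_val (?z k) = 0" for k by (induction k) auto
  then show "?x (?z k) = ?z k" for k by simp
  \<comment> \<open>Periodicity gives both the compatibility of \<open>?x\<close> with prefixes and
    the conjugation identity at the wrap-around.\<close>
  have per: "(h ^^ (n mod 2 ^ k)) (?z k) = (h ^^ n) (?z k)" for n k
    by (rule funpow_mod_eq[OF level_cycle(1)[OF assms]])
  show "tree_aut ?x"
  proof (rule tree_autI)
    show "length (?x u) = length u" for u by (simp add: tree_aut_length[OF hn])
    fix u v :: "bool list" assume "prefix u v"
    then obtain w where v: "v = u @ w" by (auto simp: prefix_def)
    have "lsb_val v mod 2 ^ length u = lsb_val u"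
      using lsb_val_less[of u] by (simp add: v lsb_val_append)
    then have "?x u = (h ^^ lsb_val v) (?z (length u))" using per by metis
    moreover have "prefix (?z (length u)) (?z (length v))"
      by (simp add: v replicate_add)
    ultimately show "prefix (?x u) (?x v)" by (simp add: tree_aut_prefix[OF hn])
  next
    show "inj ?x"
    proof (rule injI)
      fix u v assume eq: "?x u = ?x v"
      then have len: "length u = length v"
        by (metis tree_aut_length[OF hn] length_replicate)
      then have "lsb_val u = lsb_val v"
        using eq inj_onD[OF level_cycle(2)[OF assms]] lsb_val_less[of u] lsb_val_less[of v] by simp
      with len show "u = v" by (rule lsb_val_inj)
    qed
  qed
  show "?x \<circ> odometer = h \<circ> ?x"
    by (rule ext) (simp add: lsb_val_odometer tree_aut_length per)
qed

text \<open>A single commutator with the odometer suffices. The commutator equation determines the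
  differences of the portrait of \<open>x\<close> along the odometer cycle of each level, and summation by
  parts turns these differences into the pairings with \<open>dmon j\<close>.\<close>

lemma orth_Suc_commutator_odometer:
  assumes g: "tree_aut g" and o: "\<And>k. orth (Suc d) k g"
  obtains x where "tree_aut x" "\<And>k. orth d k x" "g \<circ> (odometer \<circ> x) = x \<circ> odometer"
proof -
  have dmon0: "dmon 0 v = 1" for v by (induction v) auto
  \<comment> \<open>Orthogonality at index 0 makes the level sums of \<open>g\<close> vanish, so
    \<open>g \<circ> odometer\<close> keeps the level sums of the odometer.\<close>
  have "(\<Sum>v | length v = k. portrait (g \<circ> odometer) v) = 1" for k
    using o[of k] sum_level_tree_aut[OF tree_aut_odometer, of "portrait g" k]
    by (auto simp: orth_def dmon0 portrait_comp g sum.distrib sum_portrait_odometer)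
  then obtain x where x: "tree_aut x" "x \<circ> odometer = (g \<circ> odometer) \<circ> x"
    and z: "\<And>k. x (replicate k False) = replicate k False"
    using conjugate_odometer[OF tree_aut_comp[OF g tree_aut_odometer]] by metis
  have eq: "g \<circ> (odometer \<circ> x) = x \<circ> odometer" by (simp only: x(2) comp_assoc)
  \<comment> \<open>This is the constant of summation: differences along a cycle determine the
    portrait of \<open>x\<close> only up to its value at one vertex.\<close>
  have z0: "portrait x (replicate k False) = 0" for k
    using z[of "Suc k"] by (simp add: portrait_def replicate_append_same)
  have "orth d k x" for k
  proof (induction k rule: less_induct)
    case (less k)
    have diff: "(\<Sum>v | length v = k. (portrait x v + portrait x (odometer v)) * q v) = 0"
      if q: "pol (Suc d) k q" for q
    proof -
      have "(\<Sum>v | length v = k. ((portrait odometer v + portrait odometer (x v)) +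
          (portrait x v + portrait x (odometer v))) * q v) = 0"
        using orth_iff_commutator[OF x(1) tree_aut_odometer g eq, THEN iffD1, OF o] q by blast
      then show ?thesis
        using sum_portrait_shift_0[OF x(1) less.IH q, of "portrait odometer"]
        by (subst (asm) sum_add_mult) simp
    qed
    show ?case
    \<comment> \<open>On deep levels Pascal's rule applies to all \<open>j < d\<close>.\<close>
    proof (cases "d < 2 ^ k")
      case True
      have "(\<Sum>v | length v = k. portrait x v * dmon j v) = 0" if "j < d" for j
      proof -
        have "(\<Sum>v | length v = k. portrait x v * dmon j v)
            = (\<Sum>v | length v = k. portrait x v * (dmon (Suc j) (odometer v) + dmon (Suc j) v))"
          using that True by (intro sum.cong) (simp_all add: dmon_odometer add.assoc add.commute)
        also have "\<dots> = (\<Sum>v | length v = k. (portrait x v + portrait x (odometer v)) *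
            dmon (Suc j) (odometer v))"
          by (rule sum_shift_by_parts[OF tree_aut_odometer, symmetric])
        also have "\<dots> = 0"
          by (rule diff[OF pol_comp[OF tree_aut_odometer pol_dmon]]) (use that in simp)
        finally show ?thesis .
      qed
      then show ?thesis by (simp add: orth_def)
    next
      case False
      \<comment> \<open>On shallow levels every function is an admissible test function, so the
        portrait of \<open>x\<close> is constant along the odometer cycle, hence zero by
        \<open>z0\<close>.\<close>
      have shift: "portrait x (odometer u) = portrait x u" if "length u = k" for u
      proof -
        have "(\<Sum>v | length v = k. (portrait x v + portrait x (odometer v)) * of_bool (v = u)) = 0"
          by (rule diff[OF pol_mono[OF pol_all]]) (use False in simp)
        then have "portrait x u + portrait x (odometer u) = 0"
          using that
          by (simp add: of_bool_def if_distrib[of "\<lambda>x. _ * x"] sum.delta cong: if_cong)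
        then show ?thesis by (cases "portrait x u"; cases "portrait x (odometer u)") simp_all
      qed
      have "portrait x ((odometer ^^ n) (replicate k False)) = 0" for n
        by (induction n) (simp_all add: z0 shift tree_aut_length[OF tree_aut_funpow])
      then show ?thesis by (intro orth_portrait_0) (metis odometer_power_lsb_val)
    qed
  qed
  then show thesis using that[OF x(1) _ eq] by blast
qed

section \<open>The lower central series\<close>

definition Orth :: "nat \<Rightarrow> (bool list \<Rightarrow> bool list) set" where
  "Orth d = {g. tree_aut g \<and> (\<forall>k. orth d k g)}"

lemma orth_id: "orth d k id"
  by (rule orth_portrait_0) simp

lemma subgroup_Orth: "subgroup (Orth d) W"
  by (rule W.subgroupI)
    (auto simp: Orth_def orth_inv orth_comp intro: exI[of _ id] orth_id)

lemma commutator_eq: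
  assumes "tree_aut x" "tree_aut y"
  shows "(x \<otimes>\<^bsub>W\<^esub> y \<otimes>\<^bsub>W\<^esub> inv\<^bsub>W\<^esub> x \<otimes>\<^bsub>W\<^esub> inv\<^bsub>W\<^esub> y) \<circ> (y \<circ> x) = x \<circ> y"
  using assms by (simp add: fun_eq_iff inv_W_left_apply)

lemma commutator_in_Orth:
  assumes "x \<in> Orth d" "tree_aut y"
  shows "x \<otimes>\<^bsub>W\<^esub> y \<otimes>\<^bsub>W\<^esub> inv\<^bsub>W\<^esub> x \<otimes>\<^bsub>W\<^esub> inv\<^bsub>W\<^esub> y \<in> Orth (Suc d)"
  using assms orth_commutator[OF _ _ _ commutator_eq[of x y]] by (auto simp: Orth_def)

text \<open>The base case is the whole group, as \<open>Orth 0\<close> imposes no orthogonality. In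
  the step, each element of \<open>Orth (Suc d)\<close> is itself one of the generating
  commutators.\<close>

lemma gamma_eq_Orth: "gamma (Suc d) = Orth d"
proof (induction d)
  case 0
  then show ?case by (auto simp: Orth_def orth_def)
next
  case (Suc d)
  show ?case
  proof
    show "gamma (Suc (Suc d)) \<subseteq> Orth (Suc d)"
      unfolding gamma.simps(3) Suc
      by (rule W.generate_subgroup_incl[OF _ subgroup_Orth])
        (use commutator_in_Orth in auto)
    show "Orth (Suc d) \<subseteq> gamma (Suc (Suc d))"
    proof
      fix g assume "g \<in> Orth (Suc d)"
      then have g: "tree_aut g" "\<And>k. orth (Suc d) k g" by (auto simp: Orth_def)
      obtain x where x: "tree_aut x" "\<And>k. orth d k x"
        and eq: "g \<circ> (odometer \<circ> x) = x \<circ> odometer"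
        by (rule orth_Suc_commutator_odometer[OF g], rule that)
      have "x \<circ> odometer \<circ> inv\<^bsub>W\<^esub> x \<circ> inv\<^bsub>W\<^esub> odometer = g"
        unfolding eq[symmetric] by (simp add: fun_eq_iff inv_W_right_apply x(1))
      moreover have "x \<in> gamma (Suc d)" using x by (simp add: Suc Orth_def)
      ultimately show "g \<in> gamma (Suc (Suc d))"
        unfolding gamma.simps(3)
        by (intro generate.incl UN_I[of x] UN_I[of odometer]) auto
    qed
  qed
qed

section \<open>The groups of the tower\<close>

text \<open>This will be \<open>Ln (Suc d)\<close>, described by conditions on all sufficiently deep
  levels, the form in which normalizers are computed.\<close>

definition Ev_Orth :: "nat \<Rightarrow> (bool list \<Rightarrow> bool list) set" where
  "Ev_Orth d = {g. tree_aut g \<and> (\<exists>K. \<forall>k\<ge>K. orth d k g)}"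

lemma Orth_subset_Ev_Orth: "Orth d \<subseteq> Ev_Orth d"
  by (auto simp: Orth_def Ev_Orth_def)

lemma finitary_subset_Ev_Orth: "finitary \<subseteq> Ev_Orth d"
proof
  fix f assume f: "f \<in> finitary"
  then obtain K where "\<And>v. K \<le> length v \<Longrightarrow> portrait f v = 0" by (rule finitary_portrait) blast
  then have "\<forall>k\<ge>K. orth d k f" by (auto intro: orth_portrait_0)
  then show "f \<in> Ev_Orth d" using f by (auto simp: Ev_Orth_def)
qed

lemma Ev_Orth_comp:
  assumes "g \<in> Ev_Orth d" "h \<in> Ev_Orth d" shows "g \<circ> h \<in> Ev_Orth d"
proof -
  obtain K L where "\<forall>k\<ge>K. orth d k g" "\<forall>k\<ge>L. orth d k h" and "tree_aut g" "tree_aut h"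
    using assms by (auto simp: Ev_Orth_def)
  then have "\<forall>k\<ge>max K L. orth d k (g \<circ> h)" by (simp add: orth_comp)
  with \<open>tree_aut g\<close> \<open>tree_aut h\<close> show ?thesis
    unfolding Ev_Orth_def mem_Collect_eq by (intro conjI exI[of _ "max K L"] tree_aut_comp)
qed

lemma subgroup_Ev_Orth: "subgroup (Ev_Orth d) W"
proof (rule W.subgroupI)
  show "Ev_Orth d \<noteq> {}" using Orth_subset_Ev_Orth subgroup.one_closed[OF subgroup_Orth] by blast
  show "inv\<^bsub>W\<^esub> g \<in> Ev_Orth d" if "g \<in> Ev_Orth d" for g
    using that unfolding Ev_Orth_def by (auto intro: orth_inv)
qed (auto simp: Ev_Orth_comp, auto simp: Ev_Orth_def)

text \<open>Let \<open>f\<close> be the truncation of \<open>g\<close> at the level \<open>K\<close>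
  from which its conditions hold. Removing \<open>f\<close> clears the portrait above that level and
  preserves orthogonality from there on.\<close>

lemma Ev_Orth_factor:
  assumes "g \<in> Ev_Orth d"
  obtains f h where "f \<in> finitary" "h \<in> Orth d" "g = f \<circ> h"
proof -
  obtain K where g: "tree_aut g" and K: "\<And>k. K \<le> k \<Longrightarrow> orth d k g"
    using assms by (auto simp: Ev_Orth_def)
  obtain f where f: "f \<in> finitary" "\<And>v. length v \<le> K \<Longrightarrow> f v = g v"
    "\<And>v. K \<le> length v \<Longrightarrow> portrait f v = 0" using finitary_approx[OF g] by metis
  let ?i = "inv\<^bsub>W\<^esub> f"
  let ?h = "?i \<circ> g"
  have t: "tree_aut f" "tree_aut ?i" using f by simp_all
  have "orth d k ?h" for k
  proof (cases "K \<le> k")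
    case True
    have "portrait ?i v = 0" if "length v = k" for v
      using portrait_inv[OF t(1), of "?i v"] f(3)[of "?i v"] that True
      by (simp add: tree_aut_length[OF t(2)] inv_W_right_apply[OF t(1)])
    then show ?thesis by (intro orth_comp t g K True orth_portrait_0)
  next
    case False
    show ?thesis
    proof (rule orth_portrait_0)
      fix v :: "bool list" assume "length v = k"
      then have "?h (v @ [False]) = v @ [False]"
        using False f(2)[of "v @ [False]"] inv_W_left_apply[OF t(1), of "v @ [False]"] by simp
      then show "portrait ?h v = 0" by (simp add: portrait_def)
    qed
  qed
  then have "?h \<in> Orth d" using t g by (simp add: Orth_def)
  moreover have "g = f \<circ> ?h" by (simp add: fun_eq_iff inv_W_right_apply[OF t(1)])
  ultimately show thesis using that f(1) by blast
qed

lemma Ln_eq_Ev_Orth: "Ln (Suc d) = Ev_Orth d"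
proof
  show "Ln (Suc d) \<subseteq> Ev_Orth d"
    unfolding Ln_def gamma_eq_Orth
    by (rule W.generate_subgroup_incl[OF _ subgroup_Ev_Orth])
      (use Orth_subset_Ev_Orth finitary_subset_Ev_Orth in blast)
  show "Ev_Orth d \<subseteq> Ln (Suc d)"
  proof
    fix g assume "g \<in> Ev_Orth d"
    then obtain f h where "f \<in> finitary" "h \<in> Orth d" "g = f \<circ> h" by (rule Ev_Orth_factor)
    then show "g \<in> Ln (Suc d)"
      using generate.eng[of f W "Orth d \<union> finitary" h] generate.incl[of _ "Orth d \<union> finitary" W]
      unfolding Ln_def gamma_eq_Orth by simp
  qed
qed

section \<open>Normalizers\<close>

lemma normalizer_eq:
  assumes "H \<subseteq> carrier W"
  shows "normalizer W H = {g. tree_aut g \<and> (\<lambda>h. g \<circ> h \<circ> inv\<^bsub>W\<^esub> g) ` H = H}"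
proof -
  have "g <#\<^bsub>W\<^esub> H #>\<^bsub>W\<^esub> inv\<^bsub>W\<^esub> g = (\<lambda>h. g \<circ> h \<circ> inv\<^bsub>W\<^esub> g) ` H" for g
    by (auto simp: l_coset_def r_coset_def)
  then show ?thesis using assms by (simp add: normalizer_def stabilizer_def)
qed

text \<open>The normalizer is a stabilizer, which asks for equality with the conjugate; hence both
  directions of conjugation.\<close>

lemma normalizerI:
  assumes H: "subgroup H W" and g: "tree_aut g"
    and 1: "\<And>h. h \<in> H \<Longrightarrow> g \<circ> h \<circ> inv\<^bsub>W\<^esub> g \<in> H"
    and 2: "\<And>h. h \<in> H \<Longrightarrow> inv\<^bsub>W\<^esub> g \<circ> h \<circ> g \<in> H"
  shows "g \<in> normalizer W H"
proof -
  have "h \<in> (\<lambda>h. g \<circ> h \<circ> inv\<^bsub>W\<^esub> g) ` H" if "h \<in> H" for h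
  proof (rule image_eqI[OF _ 2[OF that]])
    show "h = g \<circ> (inv\<^bsub>W\<^esub> g \<circ> h \<circ> g) \<circ> inv\<^bsub>W\<^esub> g"
      by (simp add: fun_eq_iff inv_W_right_apply[OF g])
  qed
  then show ?thesis
    using 1 g by (auto simp: normalizer_eq[OF subgroup.subset[OF H]])
qed

lemma subgroup_subset_normalizer:
  assumes H: "subgroup H W" shows "H \<subseteq> normalizer W H"
proof
  fix g assume g: "g \<in> H"
  then show "g \<in> normalizer W H"
    using subgroup.m_closed[OF H] subgroup.m_inv_closed[OF H] subgroup.mem_carrier[OF H]
    by (intro normalizerI[OF H]) (simp_all add: comp_assoc)
qed

text \<open>A conjugate of \<open>h\<close> by \<open>x\<close> is the commutator of
  \<open>x\<close> and \<open>h\<close> times \<open>h\<close>, and the commutator lies in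
  \<open>Orth (Suc d)\<close>.\<close>

lemma Orth_subset_normalizer: "Orth d \<subseteq> normalizer W (Ev_Orth (Suc d))"
proof
  fix g assume g: "g \<in> Orth d"
  have *: "x \<circ> h \<circ> inv\<^bsub>W\<^esub> x \<in> Ev_Orth (Suc d)" if x: "x \<in> Orth d" and h: "h \<in> Ev_Orth (Suc d)" for x h
  proof -
    have t: "tree_aut h" "tree_aut x" using x h by (auto simp: Orth_def Ev_Orth_def)
    have "x \<circ> h \<circ> inv\<^bsub>W\<^esub> x \<circ> inv\<^bsub>W\<^esub> h \<circ> h \<in> Ev_Orth (Suc d)"
      using Ev_Orth_comp[OF subsetD[OF Orth_subset_Ev_Orth commutator_in_Orth[OF x t(1)]] h] by simp
    moreover have "x \<circ> h \<circ> inv\<^bsub>W\<^esub> x \<circ> inv\<^bsub>W\<^esub> h \<circ> h = x \<circ> h \<circ> inv\<^bsub>W\<^esub> x"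
      by (simp add: fun_eq_iff inv_W_left_apply[OF t(1)])
    ultimately show ?thesis by simp
  qed
  have t: "tree_aut g" using g by (simp add: Orth_def)
  show "g \<in> normalizer W (Ev_Orth (Suc d))"
  proof (rule normalizerI[OF subgroup_Ev_Orth t *[OF g]])
    fix h assume "h \<in> Ev_Orth (Suc d)"
    then show "inv\<^bsub>W\<^esub> g \<circ> h \<circ> g \<in> Ev_Orth (Suc d)"
      using *[OF subgroup.m_inv_closed[OF subgroup_Orth g]] W.inv_inv[of g] t by simp
  qed
qed

lemma Ev_Orth_subset_normalizer: "Ev_Orth d \<subseteq> normalizer W (Ev_Orth (Suc d))"
proof
  fix g assume "g \<in> Ev_Orth d"
  then obtain f h where "f \<in> finitary" "h \<in> Orth d" "g = f \<circ> h" by (rule Ev_Orth_factor)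
  moreover from this have "f \<in> normalizer W (Ev_Orth (Suc d))" "h \<in> normalizer W (Ev_Orth (Suc d))"
    using Orth_subset_normalizer subgroup_subset_normalizer[OF subgroup_Ev_Orth]
      finitary_subset_Ev_Orth by blast+
  moreover have "subgroup (normalizer W (Ev_Orth (Suc d))) W"
    by (rule W.normalizer_imp_subgroup[OF subgroup.subset[OF subgroup_Ev_Orth]])
  ultimately show "g \<in> normalizer W (Ev_Orth (Suc d))"
    using subgroup.m_closed[of "normalizer W (Ev_Orth (Suc d))" W f h] by simp
qed

text \<open>The commutator of \<open>g\<close> with a deep enough truncation of the odometer recovers the pairings
  of \<open>g\<close> with \<open>dmon j\<close> from those of the commutator with \<open>dmon (Suc j)\<close>.\<close>

lemma normalizer_subset_Ev_Orth: "normalizer W (Ev_Orth (Suc d)) \<subseteq> Ev_Orth d"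
proof
  fix g assume g': "g \<in> normalizer W (Ev_Orth (Suc d))"
  note N = normalizer_eq[OF subgroup.subset[OF subgroup_Ev_Orth], of "Suc d"]
  have g: "tree_aut g" using g' by (simp add: N)
  \<comment> \<open>Depth \<open>d\<close> suffices: for \<open>j < d\<close> one has
    \<open>Suc j < 2 ^ d\<close>, so \<open>dmon j\<close> and \<open>dmon (Suc j)\<close> only see
    the first \<open>d\<close> letters.\<close>
  obtain h where h: "h \<in> finitary" "\<And>v. length v \<le> d \<Longrightarrow> h v = odometer v"
    "\<And>v. d \<le> length v \<Longrightarrow> portrait h v = 0" using finitary_approx[OF tree_aut_odometer] by metis
  have th: "tree_aut h" using h by simp
  have hE: "h \<in> Ev_Orth (Suc d)" using h finitary_subset_Ev_Orth by blast
  let ?c = "g \<otimes>\<^bsub>W\<^esub> h \<otimes>\<^bsub>W\<^esub> inv\<^bsub>W\<^esub> g \<otimes>\<^bsub>W\<^esub> inv\<^bsub>W\<^esub> h"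
  have "g \<circ> h \<circ> inv\<^bsub>W\<^esub> g \<in> Ev_Orth (Suc d)" using g' hE by (auto simp: N)
  then have c: "?c \<in> Ev_Orth (Suc d)"
    using Ev_Orth_comp subgroup.m_inv_closed[OF subgroup_Ev_Orth hE] by simp
  then obtain K where K: "\<And>k. K \<le> k \<Longrightarrow> orth (Suc d) k ?c" by (auto simp: Ev_Orth_def)
  \<comment> \<open>Beyond \<open>K\<close> the commutator is orthogonal; beyond \<open>d\<close>
    the portrait of \<open>h\<close> vanishes and vertices have the \<open>d\<close> letters that
    Pascal's rule uses.\<close>
  have "orth d k g" if "max K d \<le> k" for k
    unfolding orth_def
  proof (intro allI impI)
    fix j assume j: "j < d"
    have dmon_h: "dmon (Suc j) (h v) + dmon (Suc j) v = dmon j v" if "length v = k" for v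
    proof -
      have jd: "Suc j < 2 ^ d" using j less_exp[of d] by linarith
      have "take d (h v) = odometer (take d v)"
        using h(2)[of "take d v"] by (simp add: tree_aut_take[OF th])
      then have "dmon (Suc j) (h v) = dmon (Suc j) (odometer (take d v))"
        using dmon_take[OF jd] by metis
      also have "\<dots> = dmon (Suc j) (take d v) + dmon j (take d v)"
        using \<open>max K d \<le> k\<close> that jd by (intro dmon_odometer) simp
      also have "\<dots> = dmon (Suc j) v + dmon j v"
        using jd by (simp add: dmon_take)
      finally show ?thesis by (simp add: add.commute add.left_commute)
    qed
    have "pol (Suc d) k (\<lambda>v. dmon (Suc j) (h v))"
      by (rule pol_comp[OF th pol_dmon]) (use j in simp)
    then have "(\<Sum>v | length v = k. ((portrait h v + portrait h (g v)) +
        (portrait g v + portrait g (h v))) * dmon (Suc j) (h v)) = 0"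
      using orth_iff_commutator[OF g th _ commutator_eq[OF g th], THEN iffD1, OF _ K] that c
      by (auto simp: Ev_Orth_def)
    then have "(\<Sum>v | length v = k. (portrait g v + portrait g (h v)) * dmon (Suc j) (h v)) = 0"
      using that by (simp add: h(3) tree_aut_length[OF g])
    then have "(\<Sum>v | length v = k. portrait g v * (dmon (Suc j) (h v) + dmon (Suc j) v)) = 0"
      by (simp only: sum_shift_by_parts[OF th])
    then show "(\<Sum>v | length v = k. portrait g v * dmon j v) = 0"
      by (simp add: dmon_h)
  qed
  then show "g \<in> Ev_Orth d" using g unfolding Ev_Orth_def by blast
qed

lemma Ev_Orth_0: "Ev_Orth 0 = carrier W"
  by (auto simp: Ev_Orth_def orth_def)

text \<open>Subtraction is truncated, so the case \<open>d = 0\<close> records that the whole group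
  is its own normalizer.\<close>

lemma normalizer_Ev_Orth: "normalizer W (Ev_Orth d) = Ev_Orth (d - 1)"
proof (cases d)
  case 0
  have "normalizer W (carrier W) \<subseteq> carrier W" by (auto simp: normalizer_def stabilizer_def)
  then show ?thesis
    using 0 subgroup_subset_normalizer[OF subgroup_Ev_Orth, of 0] by (simp add: Ev_Orth_0)
next
  case (Suc e)
  then show ?thesis
    using Ev_Orth_subset_normalizer[of e] normalizer_subset_Ev_Orth[of e] by auto
qed

lemma aut_tower_Ev_Orth: "aut_tower (Ev_Orth d) m = Ev_Orth (d - m)"
  by (induction m) (simp_all add: normalizer_Ev_Orth)

text \<open>Taking normalizers, an equality of consecutive groups would propagate down to \<open>d = 0\<close>,
  where the odometer distinguishes the two groups.\<close>

lemma Ev_Orth_Suc_neq: "Ev_Orth (Suc d) \<noteq> Ev_Orth d"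
proof (induction d)
  case 0
  have "dmon 0 v = 1" for v by (induction v) auto
  then have "odometer \<notin> Ev_Orth (Suc 0)"
    by (auto simp: Ev_Orth_def orth_def sum_portrait_odometer)
  then show ?case by (auto simp: Ev_Orth_0)
next
  case (Suc d)
  then show ?case using normalizer_Ev_Orth[of "Suc (Suc d)"] normalizer_Ev_Orth[of "Suc d"] by auto
qed

text \<open>Only the vertices starting with \<open>x\<close> contribute on level
  \<open>Suc k\<close>; there \<open>dmon j\<close> restricts to zero or to
  \<open>dmon (j div 2)\<close> on the tail, and \<open>j div 2\<close> is still below
  \<open>d\<close>.\<close>

lemma below_in_Ev_Orth:
  assumes "g \<in> Ev_Orth d" shows "below [x] g \<in> Ev_Orth d"
proof -
  obtain K where g: "tree_aut g" and K: "\<And>k. K \<le> k \<Longrightarrow> orth d k g"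
    using assms by (auto simp: Ev_Orth_def)
  have "orth d (Suc k) (below [x] g)" if "K \<le> k" for k
    unfolding orth_def
  proof (intro allI impI)
    fix j assume "j < d"
    then have "(\<Sum>w | length w = k. portrait g w * dmon (j div 2) w) = 0"
      using K[OF that] by (simp add: orth_def)
    then show "(\<Sum>v | length v = Suc k. portrait (below [x] g) v * dmon j v) = 0"
      by (cases x; cases "even j") (simp_all add: sum_level_Suc portrait_below[OF g])
  qed
  then have "\<forall>k\<ge>Suc K. orth d k (below [x] g)" by (metis Suc_le_D Suc_le_mono)
  then show ?thesis using g by (auto simp: Ev_Orth_def)
qed

lemma layered_Ev_Orth: "layered (Ev_Orth d)"
  unfolding layered_def
  using subgroup_Ev_Orth below_in_Ev_Orth finitary_transitive finitary_subset_Ev_Orth by blast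

theorem theorem4p11:
  fixes n :: nat
  assumes "n \<ge> 1"
  shows "layered (Ln n) \<and> tower_height (Ln n) (n - 1) \<and>
         (\<forall>m \<le> n - 1. aut_tower (Ln n) m = Ln (n - m))"
proof -
  obtain d where n: "n = Suc d" using assms by (cases n) auto
  \<comment> \<open>The index falls by one at each stage, with a strict inclusion each time, and
    stops at 0 by truncated subtraction.\<close>
  have "tower_height (Ev_Orth d) d"
    unfolding tower_height_def aut_tower_Ev_Orth
  proof (intro conjI allI impI)
    fix k assume "k < d"
    then have "d - k = Suc (d - Suc k)" by simp
    then show "Ev_Orth (d - k) \<noteq> Ev_Orth (d - Suc k)" using Ev_Orth_Suc_neq by metis
  qed simp
  moreover have "aut_tower (Ln n) m = Ln (n - m)" if "m \<le> n - 1" for m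
    using that by (simp add: n Suc_diff_le Ln_eq_Ev_Orth aut_tower_Ev_Orth)
  ultimately show ?thesis using layered_Ev_Orth by (simp add: n Ln_eq_Ev_Orth)
qed

end
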